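(* Let $\Sigma$ be a Markov shift with finite alphabet $I$ and left shift $\sigma$, let $G$ be a countable group, let $\Psi:I^{*}\to G$ be a semigroup homomorphism, and suppose that the group-extended Markov system $(\Sigma\times G,\sigma\rtimes\Psi)$ is irreducible. Suppose that $\varphi:\Sigma\to\mathbb{R}$ depends only on the first coordinate (i.e. $\varphi(\omega)$ depends only on $\omega_1$). If $\varphi\circ\pi_1$ is recurrent, then $G$ is a recurrent group.
   Context: Markov shifts. For an alphabet $I$ (at most countable) and a matrix $A=(a(i,j))\in\{0,1\}^{I\times I}$, the Markov shift is $\Sigma=\{\omega\in I^{\mathbb{N}}: a(\omega_i,\omega_{i+1})=1\ \forall i\}$ with left shift $\sigma$; $\Sigma^n$ is the set of admissible words of length $n$ (words $\omega\in I^n$ with $a(\omega_i,\omega_{i+1})=1$ for $1\le i<n$) and $\Sigma^*=\bigcup_{n\ge1}\Sigma^n$. $I^*$ is the free semigroup on $I$ (finite non-empty words under concatenation). $\Sigma$ is irreducible if for all $i,j\in I$ there is $\omega\in\Sigma^*$ with $i\omega j\in\Sigma^*$. $S_nf=\sum_{k=0}^{n-1}f\circ\sigma^k$. Group extension. $\sigma\rtimes\Psi:\Sigma\times G\to\Sigma\times G$, $(\sigma\rtimes\Psi)(\omega,g)=(\sigma\omega,g\Psi(\omega_1))$. It is identified with the Markov shift with alphabet $I\times G$ and state space $\{((\omega_j,g_j))_j\in(I\times G)^{\mathbb{N}}:\omega\in\Sigma,\ g_j\Psi(\omega_j)=g_{j+1}\ \forall j\}$; irreducibility, pressure and recurrence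 for $\Sigma\times G$ refer to this Markov shift. $\pi_1:\Sigma\times G\to\Sigma$ is the projection. Gurevich pressure and recurrence. For an irreducible Markov shift $(\Sigma,\sigma)$ with alphabet $I$, a Hölder continuous function $f$ (functions depending only on finitely many coordinates are Hölder continuous) and $a\in I$, let $Z_n(f,a,\sigma)=\sum_{x\in\Sigma,\,x_1=a,\,\sigma^nx=x}e^{S_nf(x)}$ and $\mathcal{P}(f,\sigma)=\limsup_{n}\frac1n\log Z_n(f,a,\sigma)$ (independent of $a$). If $\mathcal{P}(f,\sigma)<\infty$, $f$ is recurrent if $\sum_{n}e^{-n\mathcal{P}(f,\sigma)}Z_n(f,a,\sigma)=\infty$ for some (hence all) $a\in I$. Recurrent group. A countable group $G$ is a recurrent group if it carries an irreducible recurrent random walk, i.e. there is a probability measure $m$ on $G$ whose support generates $G$ as a semigroup such that the random walk on $G$ with transition probabilities $p(g,h)=m(g^{-1}h)$ is recurrent. *)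

theory Defs
  imports "HOL-Algebra.Group" "HOL-Probability.Probability"
begin

text \<open>
  A Markov shift is given by an alphabet \<open>I\<close> and a relation \<open>A\<close>, where \<open>A i j\<close> stands for
  \<open>a(i,j) = 1\<close>. Sequences are indexed from 0, so \<open>\<omega> 0\<close> is the first coordinate.
\<close>

definition markov_shift :: "'i set \<Rightarrow> ('i \<Rightarrow> 'i \<Rightarrow> bool) \<Rightarrow> (nat \<Rightarrow> 'i) set" where
  "markov_shift I A = {\<omega>. (\<forall>n. \<omega> n \<in> I) \<and> (\<forall>n. A (\<omega> n) (\<omega> (Suc n)))}"

definition left_shift :: "(nat \<Rightarrow> 'i) \<Rightarrow> (nat \<Rightarrow> 'i)" where
  "left_shift \<omega> = (\<lambda>n. \<omega> (Suc n))"

definition admissible_words :: "'i set \<Rightarrow> ('i \<Rightarrow> 'i \<Rightarrow> bool) \<Rightarrow> 'i list set" where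
  "admissible_words I A = {w \<in> lists I. w \<noteq> [] \<and> successively A w}"

definition irreducible_shift :: "'i set \<Rightarrow> ('i \<Rightarrow> 'i \<Rightarrow> bool) \<Rightarrow> bool" where
  "irreducible_shift I A \<longleftrightarrow>
     (\<forall>i\<in>I. \<forall>j\<in>I. \<exists>w\<in>admissible_words I A. [i] @ w @ [j] \<in> admissible_words I A)"

definition birkhoff_sum :: "nat \<Rightarrow> ((nat \<Rightarrow> 'i) \<Rightarrow> real) \<Rightarrow> (nat \<Rightarrow> 'i) \<Rightarrow> real" where
  "birkhoff_sum n f x = (\<Sum>k<n. f ((left_shift ^^ k) x))"

definition partition_function ::
  "'i set \<Rightarrow> ('i \<Rightarrow> 'i \<Rightarrow> bool) \<Rightarrow> ((nat \<Rightarrow> 'i) \<Rightarrow> real) \<Rightarrow> 'i \<Rightarrow> nat \<Rightarrow> ennreal" where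
  "partition_function I A f a n =
     (\<Sum>\<^sub>\<infinity>x\<in>{x \<in> markov_shift I A. x 0 = a \<and> (left_shift ^^ n) x = x}.
        ennreal (exp (birkhoff_sum n f x)))"

text \<open>The logarithm \<open>[0,\<infinity>] \<rightarrow> [-\<infinity>,\<infinity>]\<close>, needed because there may be no periodic points of a given
  period, or infinitely many.\<close>

definition extended_ln :: "ennreal \<Rightarrow> ereal" where
  "extended_ln z =
     (if z = 0 then -\<infinity> else if z = \<infinity> then \<infinity> else ereal (ln (enn2real z)))"

text \<open>For irreducible shifts and Hoelder continuous \<open>f\<close> the pressure does not depend on the base
  letter \<open>a\<close>; here it is kept as a parameter.\<close>

definition gurevich_pressure ::
  "'i set \<Rightarrow> ('i \<Rightarrow> 'i \<Rightarrow> bool) \<Rightarrow> ((nat \<Rightarrow> 'i) \<Rightarrow> real) \<Rightarrow> 'i \<Rightarrow> ereal" where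
  "gurevich_pressure I A f a =
     limsup (\<lambda>n. extended_ln (partition_function I A f a n) / ereal (real n))"

text \<open>The series runs over periods \<open>n \<ge> 1\<close>. For an irreducible shift and \<open>a \<in> I\<close> there are periodic
  points through \<open>a\<close>, so the pressure is never \<open>-\<infinity>\<close> and \<open>P < \<infinity>\<close> amounts to \<open>P\<close> being a real.\<close>

definition recurrent_potential ::
  "'i set \<Rightarrow> ('i \<Rightarrow> 'i \<Rightarrow> bool) \<Rightarrow> ((nat \<Rightarrow> 'i) \<Rightarrow> real) \<Rightarrow> bool" where
  "recurrent_potential I A f \<longleftrightarrow>
     (\<exists>a\<in>I. \<exists>P::real. gurevich_pressure I A f a = ereal P \<and>
        (\<Sum>n. ennreal (exp (- real (Suc n) * P)) * partition_function I A f a (Suc n)) = \<infinity>)"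

definition depends_on_first_coordinate :: "(nat \<Rightarrow> 'i) set \<Rightarrow> ((nat \<Rightarrow> 'i) \<Rightarrow> real) \<Rightarrow> bool" where
  "depends_on_first_coordinate X f \<longleftrightarrow> (\<forall>\<omega>\<in>X. \<forall>\<omega>'\<in>X. \<omega> 0 = \<omega>' 0 \<longrightarrow> f \<omega> = f \<omega>')"

text \<open>The free semigroup has no unit: the \<open>one\<close> field only serves to fill the record, it is not in
  the carrier and plays no role in \<open>hom\<close>.\<close>

definition free_semigroup :: "'i set \<Rightarrow> 'i list monoid" where
  "free_semigroup I = \<lparr>carrier = lists I - {[]}, monoid.mult = (@), one = []\<rparr>"

text \<open>The group extension as a Markov shift with alphabet \<open>I \<times> G\<close>.\<close>

definition extension_matrix ::
  "('i \<Rightarrow> 'i \<Rightarrow> bool) \<Rightarrow> ('g, 'b) monoid_scheme \<Rightarrow> ('i list \<Rightarrow> 'g) \<Rightarrow> 'i \<times> 'g \<Rightarrow> 'i \<times> 'g \<Rightarrow> bool" where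
  "extension_matrix A G \<Psi> = (\<lambda>(i, g) (j, h). A i j \<and> g \<otimes>\<^bsub>G\<^esub> \<Psi> [i] = h)"

definition proj_base :: "(nat \<Rightarrow> 'i \<times> 'g) \<Rightarrow> (nat \<Rightarrow> 'i)" where
  "proj_base x = (\<lambda>n. fst (x n))"

lemma markov_shift_extension:
  "markov_shift (I \<times> carrier G) (extension_matrix A G \<Psi>) =
     {x. proj_base x \<in> markov_shift I A \<and> (\<forall>n. snd (x n) \<in> carrier G) \<and>
         (\<forall>n. snd (x n) \<otimes>\<^bsub>G\<^esub> \<Psi> [fst (x n)] = snd (x (Suc n)))}"
  by (auto simp: markov_shift_def extension_matrix_def proj_base_def mem_Times_iff
      split: prod.splits) (metis fst_conv snd_conv prod.collapse)+

text \<open>The projection to \<open>\<Sigma> \<times> G\<close> conjugates the shift with the skew product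
  \<open>(\<omega>, g) \<mapsto> (\<sigma> \<omega>, g \<Psi>(\<omega>\<^sub>1))\<close>.\<close>

lemma extension_skew_product:
  assumes "x \<in> markov_shift (I \<times> carrier G) (extension_matrix A G \<Psi>)"
  shows "(proj_base (left_shift x), snd (left_shift x 0)) =
         (left_shift (proj_base x), snd (x 0) \<otimes>\<^bsub>G\<^esub> \<Psi> [proj_base x 0])"
  using assms unfolding markov_shift_extension
  by (simp add: proj_base_def left_shift_def)

inductive_set semigroup_generate :: "('g, 'b) monoid_scheme \<Rightarrow> 'g set \<Rightarrow> 'g set"
  for G (structure) and S where
  incl: "s \<in> S \<Longrightarrow> s \<in> semigroup_generate G S"
| mult: "s \<in> semigroup_generate G S \<Longrightarrow> t \<in> semigroup_generate G S \<Longrightarrow>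
         s \<otimes> t \<in> semigroup_generate G S"

text \<open>The position at time \<open>n\<close> of the walk started at \<open>g\<close> with increments \<open>\<xi>\<close>. If the increments are
  independent with law \<open>m\<close>, this is the Markov chain with transition probabilities
  \<open>p(g,h) = m(g\<^sup>-\<^sup>1 h)\<close>.\<close>

primrec walk :: "('g, 'b) monoid_scheme \<Rightarrow> 'g \<Rightarrow> (nat \<Rightarrow> 'g) \<Rightarrow> nat \<Rightarrow> 'g" where
  "walk G g \<xi> 0 = g"
| "walk G g \<xi> (Suc n) = walk G g \<xi> n \<otimes>\<^bsub>G\<^esub> \<xi> n"

text \<open>Recurrence: almost surely the walk returns to its starting point.\<close>

definition recurrent_walk :: "('g, 'b) monoid_scheme \<Rightarrow> 'g pmf \<Rightarrow> bool" where
  "recurrent_walk G m \<longleftrightarrow>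
     (\<forall>g\<in>carrier G. AE \<xi> in \<Pi>\<^sub>M n\<in>(UNIV :: nat set). measure_pmf m. \<exists>n\<ge>1. walk G g \<xi> n = g)"

text \<open>On a countable group every probability measure is discrete, i.e. a \<open>pmf\<close>.\<close>

definition recurrent_group :: "('g, 'b) monoid_scheme \<Rightarrow> bool" where
  "recurrent_group G \<longleftrightarrow>
     (\<exists>m :: 'g pmf. set_pmf m \<subseteq> carrier G \<and> semigroup_generate G (set_pmf m) = carrier G \<and>
        recurrent_walk G m)"

end

theory Submission
  imports Defs
begin

text \<open>
  Fix a letter \<open>a\<close> at which the recurrence series diverges and let \<open>f i\<close> be the value of \<open>\<phi>\<close> on
  sequences starting with \<open>i\<close>. A word is given the product of the weights \<open>exp (f i - P)\<close> of its
  letters, with \<open>P\<close> the pressure of \<open>\<phi> \<circ> \<pi>\<^sub>1\<close>. Cutting a loop at \<open>a\<close> at all its visits to \<open>a\<close> factors it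
  uniquely into first return words, so the weights of the first return words, pushed to \<open>G\<close> by \<open>\<Psi>\<close>,
  form a measure \<open>\<mu>\<close> on \<open>G\<close> whose Green function \<open>\<Sum>n. \<mu>\<^sup>*\<^sup>n\<close> has at the unit the value
  \<open>1 + (\<Sum>n\<ge>1. exp (- n P) Z\<^sub>n)\<close>. Recurrence of the potential says that this Green function is infinite;
  that \<open>P\<close> is the pressure says that it becomes finite as soon as every letter weight is multiplied by
  some \<open>s < 1\<close>. The measure \<open>\<mu>\<close> need not have mass one, since \<open>P\<close> can be smaller than the pressure of \<open>\<phi>\<close>
  itself; it has to be normalised by a harmonic function.

  This is done by the potential theory of a critical kernel that commutes with left translations.
  Normalised Green functions of the subcritical kernels have, by Fatou's lemma, a superharmonic limit
  with value 1 at the unit (\<open>superharmonic_limit\<close>). Hence the least superharmonic function \<open>h\<close> with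
  \<open>h \<one> \<ge> 1\<close> satisfies \<open>h \<one> = 1\<close>. As the Green function is infinite, finite superharmonic functions are
  harmonic (\<open>harmonic_if_green_infinite\<close>). The translates of \<open>h\<close> are harmonic too, and minimality of
  \<open>h\<close> with a minimum principle gives \<open>h (g \<otimes> x) = h g * h x\<close>
  (\<open>multiplicative_harmonic_function\<close>). So \<open>m = h \<mu>\<close> is a probability measure, and because \<open>h\<close> is
  multiplicative, \<open>m\<^sup>*\<^sup>n = h \<mu>\<^sup>*\<^sup>n\<close>: the Green function of \<open>m\<close> at the unit is still infinite.

  The random walk with law \<open>m\<close> is then recurrent: the probability of ever hitting \<open>g\<close>, as a function
  of the starting point, is superharmonic for \<open>m\<close>, hence harmonic, and harmonicity at \<open>g\<close> itself says
  that the return probability is 1 (\<open>recurrent_walk_if_green_infinite\<close>). The support of \<open>m\<close> is the set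
  of values of first return words, which generates \<open>G\<close> as a semigroup because the group extension is
  irreducible (\<open>first_return_values_generate\<close>).
\<close>

section \<open>Weighted steps on a group and superharmonic functions\<close>

locale group_steps = group G for G (structure) +
  fixes \<psi> :: "'s \<Rightarrow> 'a"
  assumes step_closed [simp]: "\<psi> b \<in> carrier G"
begin

text \<open>
  The transition operator of the walk with right increments \<open>\<psi> b\<close>, chosen with the possibly
  unnormalised weight \<open>w b\<close>. Working with an index set of steps instead of a measure on \<open>G\<close> keeps
  the steps visible, so that iterates become sums over words of steps.
\<close>

definition avg :: "('s \<Rightarrow> ennreal) \<Rightarrow> ('a \<Rightarrow> ennreal) \<Rightarrow> 'a \<Rightarrow> ennreal" where
  "avg w u x = (\<integral>\<^sup>+b. w b * u (x \<otimes> \<psi> b) \<partial>count_space UNIV)"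

definition green :: "('s \<Rightarrow> ennreal) \<Rightarrow> 'a \<Rightarrow> ennreal" where
  "green w x = (\<Sum>n. (avg w ^^ n) (indicator {\<one>}) x)"

definition superharmonic :: "('s \<Rightarrow> ennreal) \<Rightarrow> ('a \<Rightarrow> ennreal) \<Rightarrow> bool" where
  "superharmonic w u \<longleftrightarrow> (\<forall>x\<in>carrier G. avg w u x \<le> u x)"

lemma avg_mono:
  assumes "\<And>b. w b \<le> w' b" "\<And>y. y \<in> carrier G \<Longrightarrow> u y \<le> v y" "x \<in> carrier G"
  shows "avg w u x \<le> avg w' v x"
  unfolding avg_def using assms by (intro nn_integral_mono mult_mono) auto

lemma avg_cong:
  assumes "\<And>y. y \<in> carrier G \<Longrightarrow> u y = v y" "x \<in> carrier G"
  shows "avg w u x = avg w v x"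
  unfolding avg_def using assms by (intro nn_integral_cong) auto

lemma avg_add: "avg w (\<lambda>y. u y + v y) x = avg w u x + avg w v x"
  unfolding avg_def by (simp add: distrib_left nn_integral_add)

lemma avg_cmult: "avg w (\<lambda>y. c * u y) x = c * avg w u x"
  unfolding avg_def by (simp add: nn_integral_cmult[symmetric] mult.left_commute)

lemma avg_translate:
  assumes "g \<in> carrier G" "x \<in> carrier G"
  shows "avg w (\<lambda>y. u (g \<otimes> y)) x = avg w u (g \<otimes> x)"
  unfolding avg_def using assms by (intro nn_integral_cong) (simp add: m_assoc)

lemma avg_power_mono:
  assumes "\<And>y. y \<in> carrier G \<Longrightarrow> u y \<le> v y" "x \<in> carrier G"
  shows "(avg w ^^ n) u x \<le> (avg w ^^ n) v x"
  using assms by (induction n arbitrary: x) (auto intro!: avg_mono)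

lemma avg_power_cong:
  assumes "\<And>y. y \<in> carrier G \<Longrightarrow> u y = v y" "x \<in> carrier G"
  shows "(avg w ^^ n) u x = (avg w ^^ n) v x"
  by (rule antisym; rule avg_power_mono) (use assms in auto)

lemma avg_power_add:
  "(avg w ^^ n) (\<lambda>y. u y + v y) x = (avg w ^^ n) u x + (avg w ^^ n) v x"
proof (induction n arbitrary: x)
  case (Suc n)
  have "(avg w ^^ n) (\<lambda>y. u y + v y) = (\<lambda>x. (avg w ^^ n) u x + (avg w ^^ n) v x)"
    using Suc.IH by auto
  then show ?case by (simp add: avg_add)
qed simp

lemma avg_power_cmult: "(avg w ^^ n) (\<lambda>y. c * u y) x = c * (avg w ^^ n) u x"
proof (induction n arbitrary: x)
  case (Suc n)
  have "(avg w ^^ n) (\<lambda>y. c * u y) = (\<lambda>x. c * (avg w ^^ n) u x)"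
    using Suc.IH by auto
  then show ?case by (simp add: avg_cmult)
qed simp

lemma avg_power_translate:
  assumes "g \<in> carrier G" "x \<in> carrier G"
  shows "(avg w ^^ n) (\<lambda>y. u (g \<otimes> y)) x = (avg w ^^ n) u (g \<otimes> x)"
  using assms(2)
proof (induction n arbitrary: x)
  case (Suc n)
  have "(avg w ^^ Suc n) (\<lambda>y. u (g \<otimes> y)) x = avg w (\<lambda>y. (avg w ^^ n) u (g \<otimes> y)) x"
    using Suc by (auto intro!: avg_cong)
  then show ?case using Suc.prems assms(1) by (simp add: avg_translate)
qed simp

lemma superharmonic_translate:
  assumes "superharmonic w u" "g \<in> carrier G"
  shows "superharmonic w (\<lambda>y. u (g \<otimes> y))"
  using assms by (simp add: superharmonic_def avg_translate)

lemma superharmonic_cmult: "superharmonic w u \<Longrightarrow> superharmonic w (\<lambda>y. c * u y)"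
  by (auto simp: superharmonic_def avg_cmult intro: mult_left_mono)

text \<open>
  A Harnack inequality whose constant is uniform in \<open>u\<close> and \<open>x\<close>: a product of steps of positive weight
  is reached from \<open>x\<close> with at least the product of their weights.
\<close>

lemma superharmonic_comparison:
  assumes "k \<in> semigroup_generate G (\<psi> ` {b. w b \<noteq> 0})"
  shows "\<exists>c>0. \<forall>u x. superharmonic w u \<longrightarrow> x \<in> carrier G \<longrightarrow> c * u (x \<otimes> k) \<le> u x"
  using assms
proof (induction)
  case (incl s)
  then obtain b where b: "w b \<noteq> 0" "s = \<psi> b" by auto
  have "w b * u (x \<otimes> \<psi> b) \<le> u x" if "superharmonic w u" "x \<in> carrier G" for u x
  proof -
    have "w b * u (x \<otimes> \<psi> b) \<le> avg w u x"
      unfolding avg_def by (rule nn_integral_ge_point) simp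
    also have "\<dots> \<le> u x" using that by (auto simp: superharmonic_def)
    finally show ?thesis .
  qed
  with b show ?case by (intro exI[of _ "w b"]) (auto simp: zero_less_iff_neq_zero)
next
  case (mult s t)
  from mult obtain c where c: "c > 0"
    "\<And>u x. superharmonic w u \<Longrightarrow> x \<in> carrier G \<Longrightarrow> c * u (x \<otimes> s) \<le> u x" by blast
  from mult obtain d where d: "d > 0"
    "\<And>u x. superharmonic w u \<Longrightarrow> x \<in> carrier G \<Longrightarrow> d * u (x \<otimes> t) \<le> u x" by blast
  have cl: "r \<in> carrier G" if "r \<in> semigroup_generate G (\<psi> ` {b. w b \<noteq> 0})" for r
    using that by induction auto
  have "c * d * u (x \<otimes> (s \<otimes> t)) \<le> u x" if u: "superharmonic w u" and x: "x \<in> carrier G" for u x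
  proof -
    have "c * d * u (x \<otimes> (s \<otimes> t)) = c * (d * u (x \<otimes> s \<otimes> t))"
      using cl mult.hyps x by (simp add: m_assoc mult.assoc)
    also have "\<dots> \<le> c * u (x \<otimes> s)"
      using cl mult.hyps x by (intro mult_left_mono d(2) u) auto
    also have "\<dots> \<le> u x" by (rule c(2)[OF u x])
    finally show ?thesis .
  qed
  moreover have "c * d > 0" using c(1) d(1) by (simp add: ennreal_zero_less_mult_iff)
  ultimately show ?case by blast
qed

text \<open>
  Riesz decomposition: \<open>u\<close> dominates the potential of the defect \<open>d = u - avg w u\<close>, and by translation
  invariance that potential is at \<open>x\<close> at least \<open>d x\<close> times the Green function at the unit. If the latter
  is infinite and \<open>u x\<close> is not, the defect vanishes at \<open>x\<close>.
\<close>

lemma harmonic_if_green_infinite: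
  assumes green: "green w \<one> = \<infinity>" and u: "superharmonic w u"
    and x: "x \<in> carrier G" and fin: "u x < \<infinity>"
  shows "avg w u x = u x"
proof -
  define d where "d y = u y - avg w u y" for y
  have split: "u y = d y + avg w u y" if "y \<in> carrier G" for y
    using that u by (simp add: d_def superharmonic_def diff_add_cancel_ennreal)
  have telescope: "u x = (\<Sum>n<N. (avg w ^^ n) d x) + (avg w ^^ N) u x" for N
  proof (induction N)
    case (Suc N)
    have "(avg w ^^ N) u x = (avg w ^^ N) (\<lambda>y. d y + avg w u y) x"
      using x by (intro avg_power_cong split) auto
    also have "\<dots> = (avg w ^^ N) d x + (avg w ^^ Suc N) u x"
      by (simp add: avg_power_add funpow_swap1)
    finally show ?case using Suc.IH by (simp add: add.assoc)
  qed simp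
  have point: "d x * (avg w ^^ n) (indicator {\<one>}) \<one> \<le> (avg w ^^ n) d x" for n
  proof -
    have "d x * (avg w ^^ n) (indicator {\<one>}) \<one> = (avg w ^^ n) (\<lambda>y. d x * indicator {\<one>} y) \<one>"
      by (simp add: avg_power_cmult)
    also have "\<dots> \<le> (avg w ^^ n) (\<lambda>y. d (x \<otimes> y)) \<one>"
      using x by (intro avg_power_mono) (auto split: split_indicator)
    also have "\<dots> = (avg w ^^ n) d x" using x by (simp add: avg_power_translate)
    finally show ?thesis .
  qed
  have "d x * green w \<one> = (\<Sum>n. d x * (avg w ^^ n) (indicator {\<one>}) \<one>)"
    by (simp add: green_def)
  also have "\<dots> \<le> u x"
  proof (rule suminf_le_const[OF summableI])
    fix N
    have "(\<Sum>n<N. d x * (avg w ^^ n) (indicator {\<one>}) \<one>) \<le> (\<Sum>n<N. (avg w ^^ n) d x)"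
      by (intro sum_mono point)
    also have "\<dots> \<le> u x" by (subst telescope[of N]) simp
    finally show "(\<Sum>n<N. d x * (avg w ^^ n) (indicator {\<one>}) \<one>) \<le> u x" .
  qed
  finally have "d x = 0" using fin green by (auto simp: ennreal_mult_top split: if_splits)
  then show ?thesis using split[OF x] by simp
qed

lemma green_superharmonic: "superharmonic w (green w)"
  unfolding superharmonic_def
proof
  fix x assume "x \<in> carrier G"
  let ?T = "\<lambda>n. (avg w ^^ n) (indicator {\<one>})"
  have "avg w (green w) x = (\<integral>\<^sup>+b. (\<Sum>n. w b * ?T n (x \<otimes> \<psi> b)) \<partial>count_space UNIV)"
    unfolding avg_def[of w "green w"] green_def by simp
  also have "\<dots> = (\<Sum>n. avg w (?T n) x)"
    unfolding avg_def[of w "?T _"] by (rule nn_integral_suminf) simp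
  also have "\<dots> \<le> green w x"
  proof (rule suminf_le_const[OF summableI])
    fix N
    have "(\<Sum>n<N. avg w (?T n) x) \<le> (\<Sum>n<Suc N. ?T n x)"
      by (subst sum.lessThan_Suc_shift) simp
    also have "\<dots> \<le> green w x"
      unfolding green_def by (rule sum_le_suminf) auto
    finally show "(\<Sum>n<N. avg w (?T n) x) \<le> green w x" .
  qed
  finally show "avg w (green w) x \<le> green w x" .
qed

text \<open>
  The witness is the lower limit of the normalised Green functions of the subcritical weights. For a
  fixed \<open>J\<close> the operator \<open>avg (w J)\<close> lies below \<open>avg (w j)\<close> for all later \<open>j\<close>, so Fatou's lemma makes the
  limit superharmonic for every \<open>w J\<close>, and monotone convergence passes to \<open>wlim\<close>. Because of
  its value 1 at the unit, the least superharmonic function that is at least 1 there is equal to 1 there.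
\<close>

lemma superharmonic_limit:
  assumes mono: "incseq w" and sup: "\<And>b. wlim b = (SUP j. w j b)"
    and fin: "\<And>j. green (w j) \<one> < \<infinity>"
  obtains v where "superharmonic wlim v" "v \<one> = 1"
proof -
  define u where "u j x = green (w j) x / green (w j) \<one>" for j x
  have pos: "green (w j) \<one> \<ge> 1" for j
  proof -
    have "(\<Sum>n<1. (avg (w j) ^^ n) (indicator {\<one>}) \<one>) \<le> green (w j) \<one>"
      unfolding green_def by (rule sum_le_suminf) auto
    then show ?thesis by simp
  qed
  have u1: "u j \<one> = 1" for j
    using fin[of j] pos[of j] by (auto simp: u_def intro!: ennreal_divide_self)
  have super: "avg (w j) (u j) x \<le> u j x" if "x \<in> carrier G" for j x
    using superharmonic_cmult[OF green_superharmonic, of "w j" "inverse (green (w j) \<one>)"] that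
    by (simp add: superharmonic_def u_def[abs_def] divide_ennreal_def mult.commute)
  define v where "v x = liminf (\<lambda>j. u j x)" for x
  have "avg (w J) v x \<le> v x" if x: "x \<in> carrier G" for J x
  proof -
    have "avg (w J) v x \<le> (\<integral>\<^sup>+b. liminf (\<lambda>j. w J b * u j (x \<otimes> \<psi> b)) \<partial>count_space UNIV)"
      unfolding avg_def v_def liminf_SUP_INF SUP_mult_left_ennreal
      by (intro nn_integral_mono SUP_subset_mono INF_greatest mult_left_mono INF_lower) auto
    also have "\<dots> \<le> liminf (\<lambda>j. avg (w J) (u j) x)"
      unfolding avg_def by (rule nn_integral_liminf) simp
    also have "\<dots> \<le> liminf (\<lambda>j. u j x)"
    proof (rule Liminf_mono, rule eventually_sequentiallyI)
      fix j assume "J \<le> j"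
      then have "avg (w J) (u j) x \<le> avg (w j) (u j) x"
        using mono x by (intro avg_mono) (auto simp: incseq_def le_fun_def)
      also have "\<dots> \<le> u j x" by (rule super[OF x])
      finally show "avg (w J) (u j) x \<le> u j x" .
    qed
    finally show ?thesis by (simp add: v_def)
  qed
  moreover have "avg wlim v x = (SUP J. avg (w J) v x)" for x
  proof -
    have "avg wlim v x = (\<integral>\<^sup>+b. (SUP J. w J b * v (x \<otimes> \<psi> b)) \<partial>count_space UNIV)"
      unfolding avg_def by (simp add: sup SUP_mult_right_ennreal)
    also have "\<dots> = (SUP J. avg (w J) v x)"
      unfolding avg_def
      using mono by (intro nn_integral_monotone_convergence_SUP)
        (auto simp: incseq_def le_fun_def intro!: mult_right_mono)
    finally show ?thesis .
  qed
  ultimately have "superharmonic wlim v"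
    by (auto simp: superharmonic_def intro!: SUP_least)
  moreover have "v \<one> = 1" by (simp add: v_def u1 Liminf_const)
  ultimately show thesis by (rule that)
qed

section \<open>A multiplicative harmonic function for a critical weight\<close>

text \<open>
  In terms of the kernel, \<open>h x\<close> is the total weight of the paths from \<open>x\<close> that stop at their first
  visit to the unit. It is obtained as the least superharmonic function with value at least 1 at the
  unit, which makes the comparison with the translates of \<open>h\<close> immediate.
\<close>

lemma multiplicative_harmonic_function:
  assumes mono: "incseq w" and sup: "\<And>b. wlim b = (SUP j. w j b)"
    and fin: "\<And>j. green (w j) \<one> < \<infinity>" and inf: "green wlim \<one> = \<infinity>"
    and gen: "semigroup_generate G (\<psi> ` {b. wlim b \<noteq> 0}) = carrier G"
  obtains h where "h \<one> = 1" "\<And>x. x \<in> carrier G \<Longrightarrow> 0 < h x \<and> h x < \<infinity>"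
    "\<And>x y. x \<in> carrier G \<Longrightarrow> y \<in> carrier G \<Longrightarrow> h (x \<otimes> y) = h x * h y"
    "avg wlim h \<one> = 1"
proof -
  obtain v where v: "superharmonic wlim v" "v \<one> = 1"
    using superharmonic_limit[OF mono sup fin] by blast
  define h where "h x = (INF u\<in>{u. superharmonic wlim u \<and> 1 \<le> u \<one>}. u x)" for x
  have h_le: "h x \<le> u x" if "superharmonic wlim u" "1 \<le> u \<one>" for u x
    unfolding h_def using that by (intro INF_lower) auto
  have h1: "h \<one> = 1"
  proof (rule antisym)
    show "h \<one> \<le> 1" using h_le[OF v(1), of \<one>] v(2) by simp
    show "1 \<le> h \<one>" unfolding h_def by (rule INF_greatest) simp
  qed
  have h_super: "superharmonic wlim h"
    unfolding superharmonic_def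
  proof
    fix x assume x: "x \<in> carrier G"
    have "avg wlim h x \<le> u x" if u: "superharmonic wlim u" "1 \<le> u \<one>" for u
    proof -
      have "avg wlim h x \<le> avg wlim u x" by (rule avg_mono[OF order_refl h_le[OF u] x])
      also have "\<dots> \<le> u x" using u x by (simp add: superharmonic_def)
      finally show ?thesis .
    qed
    then show "avg wlim h x \<le> h x" unfolding h_def[of x] by (intro INF_greatest) auto
  qed
  have reach: "\<exists>c>0. \<forall>u x. superharmonic wlim u \<longrightarrow> x \<in> carrier G \<longrightarrow> c * u (x \<otimes> k) \<le> u x"
    if "k \<in> carrier G" for k
    using superharmonic_comparison[of k wlim] that gen by simp
  \<comment> \<open>The steps of positive weight generate the group, which turns the value 1 at the unit into bounds everywhere.\<close>
  have h_bounds: "0 < h x \<and> h x < \<infinity>" if x: "x \<in> carrier G" for x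
  proof
    obtain c where c: "c > 0" "c * h (x \<otimes> inv x) \<le> h x"
      using reach[of "inv x"] h_super x by (meson inv_closed)
    then show "0 < h x" using x h1 by (simp add: less_le_trans)
    obtain d where d: "d > 0" "d * h (\<one> \<otimes> x) \<le> h \<one>"
      using reach[of x] h_super x by (meson one_closed)
    then have "d * h x \<noteq> \<infinity>" using x h1 by (auto simp: top_unique)
    with d(1) show "h x < \<infinity>" by (auto simp: ennreal_mult_eq_top_iff top.not_eq_extremum)
  qed
  have h_harm: "avg wlim h x = h x" if "x \<in> carrier G" for x
    using harmonic_if_green_infinite[OF inf h_super that] h_bounds[OF that] by simp
  have "h (g \<otimes> x) = h g * h x" if g: "g \<in> carrier G" and x: "x \<in> carrier G" for g x
  proof -
    have "superharmonic wlim (\<lambda>y. inverse (h g) * h (g \<otimes> y))"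
      by (intro superharmonic_cmult superharmonic_translate h_super g)
    moreover have inv_g: "h g * inverse (h g) = 1"
      using h_bounds[OF g] by (metis ennreal_divide_self divide_ennreal_def less_irrefl infinity_ennreal_def)
    ultimately have "h y \<le> inverse (h g) * h (g \<otimes> y)" for y
      using g by (intro h_le) (auto simp: mult.commute)
    then have "h g * h y \<le> h g * (inverse (h g) * h (g \<otimes> y))" for y
      by (rule mult_left_mono) simp
    then have ge: "h g * h y \<le> h (g \<otimes> y)" for y
      using inv_g by (simp add: mult.assoc[symmetric])
    \<comment> \<open>The difference of two harmonic functions is nonnegative by minimality and vanishes at the unit.\<close>
    define d where "d y = h (g \<otimes> y) - h g * h y" for y
    have split: "h (g \<otimes> y) = d y + h g * h y" for y
      using ge by (simp add: d_def diff_add_cancel_ennreal)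
    have "avg wlim d y = d y" if y: "y \<in> carrier G" for y
    proof -
      have "d y + h g * h y = avg wlim (\<lambda>y. h (g \<otimes> y)) y"
        using g y by (simp add: split[symmetric] avg_translate h_harm)
      also have "\<dots> = avg wlim d y + h g * h y"
        using y by (simp add: split avg_add avg_cmult h_harm)
      finally show ?thesis
        using h_bounds[OF g] h_bounds[OF y]
        by (auto simp: add.commute[of _ "h g * h y"] ennreal_add_left_cancel ennreal_mult_eq_top_iff)
    qed
    then have "superharmonic wlim d" by (simp add: superharmonic_def)
    then obtain c where c: "c > 0" "c * d (\<one> \<otimes> x) \<le> d \<one>"
      using reach[OF x] by (meson one_closed)
    moreover have "d \<one> = 0" using g h1 h_bounds[OF g] by (auto simp: d_def intro!: ennreal_minus_eq_0)
    ultimately have "d x = 0" using x by (auto simp: mult_eq_0_iff)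
    then show ?thesis using split[of x] by simp
  qed
  with h1 h_bounds h_harm show thesis by (intro that[of h]) auto
qed

text \<open>
  The Doob transform by a multiplicative \<open>h\<close> is again a convolution, since the factor
  \<open>h (x \<otimes> \<psi> b) / h x\<close> depends on the step only.
\<close>

lemma doob_transform_power:
  assumes mult: "\<And>x y. x \<in> carrier G \<Longrightarrow> y \<in> carrier G \<Longrightarrow> h (x \<otimes> y) = h x * h y"
    and x: "x \<in> carrier G"
  shows "h x * (avg (\<lambda>b. w b * h (\<psi> b)) ^^ n) u x = (avg w ^^ n) (\<lambda>y. h y * u y) x"
  using x
proof (induction n arbitrary: x)
  case (Suc n)
  let ?w = "\<lambda>b. w b * h (\<psi> b)"
  have "h x * (avg ?w ^^ Suc n) u x
      = (\<integral>\<^sup>+b. h x * (w b * h (\<psi> b) * (avg ?w ^^ n) u (x \<otimes> \<psi> b)) \<partial>count_space UNIV)"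
    by (simp add: avg_def[of ?w "_ u"] nn_integral_cmult)
  also have "\<dots> = avg w (\<lambda>y. h y * (avg ?w ^^ n) u y) x"
    unfolding avg_def[of w] using Suc.prems by (intro nn_integral_cong) (simp add: mult mult_ac)
  also have "\<dots> = avg w ((avg w ^^ n) (\<lambda>y. h y * u y)) x"
    using Suc.prems by (intro avg_cong Suc.IH)
  finally show ?case by simp
qed simp

section \<open>Recurrence of random walks with infinite Green function\<close>

lemma walk_first_step: "walk G x (case_nat s \<xi>) (Suc n) = walk G (x \<otimes>\<^bsub>G\<^esub> s) \<xi> n"
  by (induction n) auto

text \<open>
  By the first step decomposition, averaging the probability of hitting \<open>g\<close> at some time \<open>n \<ge> 0\<close> gives
  the probability of hitting \<open>g\<close> at some time \<open>n \<ge> 1\<close>. Hence the former is superharmonic, so it is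
  harmonic, and since it is 1 at \<open>g\<close>, its harmonicity at \<open>g\<close> is the statement that the walk returns almost surely.
\<close>

lemma recurrent_walk_if_green_infinite:
  fixes p :: "'s pmf"
  assumes count: "countable (carrier G)"
    and green: "green (\<lambda>b. ennreal (pmf p b)) \<one> = \<infinity>"
  shows "recurrent_walk G (map_pmf \<psi> p)"
  unfolding recurrent_walk_def
proof
  fix g assume g: "g \<in> carrier G"
  let ?M = "measure_pmf (map_pmf \<psi> p)"
  interpret sequence_space ?M ..
  \<comment> \<open>The type of group elements may be uncountable, in which case the group operation need not be
    measurable on the product of discrete spaces. Projecting the increments to the countable carrier
    makes the walk measurable and changes it on a null set only.\<close>
  define c where "c k = (if k \<in> carrier G then k else \<one>)" for k
  define W where "W x \<xi> n = walk G x (\<lambda>i. c (\<xi> i)) n" for x \<xi> n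
  have c_closed [simp]: "c k \<in> carrier G" for k by (simp add: c_def)
  have W_meas: "(\<lambda>\<xi>. W x \<xi> n) \<in> S \<rightarrow>\<^sub>M count_space (carrier G)" if x: "x \<in> carrier G" for x n
  proof (induction n)
    case 0
    then show ?case using x by (simp add: W_def)
  next
    case (Suc n)
    have "(\<lambda>\<xi>. k \<otimes> c (\<xi> n)) \<in> S \<rightarrow>\<^sub>M count_space (carrier G)" if "k \<in> carrier G" for k
      using that by (intro measurable_compose[OF measurable_component_singleton[of n]]) auto
    from measurable_compose_countable'[OF this Suc count]
    show ?case by (simp add: W_def)
  qed
  have W_event: "{\<xi> \<in> space S. W x \<xi> n = g} \<in> sets S" if "x \<in> carrier G" for x n
    using measurable_sets[OF W_meas[OF that, of n], of "{g}"] g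
    by (simp add: vimage_def Int_def conj_commute)
  define H where "H x = {\<xi> \<in> space S. \<exists>n. W x \<xi> n = g}" for x
  define H1 where "H1 x = {\<xi> \<in> space S. \<exists>n\<ge>1. W x \<xi> n = g}" for x
  have H_sets: "H x \<in> sets S" if "x \<in> carrier G" for x
    unfolding H_def using W_event[OF that] by measurable
  have H1_sets: "H1 x \<in> sets S" if "x \<in> carrier G" for x
    unfolding H1_def using W_event[OF that] by measurable
  have first_step: "emeasure S (H1 x) = avg (\<lambda>b. ennreal (pmf p b)) (\<lambda>y. emeasure S (H y)) x"
    if x: "x \<in> carrier G" for x
  proof -
    let ?f = "\<lambda>(s, \<xi>). case_nat s \<xi>"
    have f: "?f \<in> ?M \<Otimes>\<^sub>M S \<rightarrow>\<^sub>M S" by measurable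
    have step: "(case_nat s \<xi> \<in> H1 x) = (\<xi> \<in> H (x \<otimes> c s))" if "\<xi> \<in> space S" for s \<xi>
    proof -
      have "(\<lambda>i. c (case_nat s \<xi> i)) = case_nat (c s) (\<lambda>i. c (\<xi> i))"
        by (auto split: nat.split)
      then have "W x (case_nat s \<xi>) (Suc n) = W (x \<otimes> c s) \<xi> n" for n
        unfolding W_def by (simp only: walk_first_step)
      moreover have "(\<exists>n\<ge>1. P n) = (\<exists>n. P (Suc n))" for P
        by (metis One_nat_def Suc_le_D le_add1 plus_1_eq_Suc)
      ultimately show ?thesis using that by (simp add: H_def H1_def space_PiM)
    qed
    have "emeasure S (H1 x) = emeasure (distr (?M \<Otimes>\<^sub>M S) S ?f) (H1 x)"
      by (simp add: PiM_iter)
    also have "\<dots> = emeasure (?M \<Otimes>\<^sub>M S) (?f -` H1 x \<inter> space (?M \<Otimes>\<^sub>M S))"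
      by (rule emeasure_distr[OF f H1_sets[OF x]])
    also have "\<dots> = (\<integral>\<^sup>+s. emeasure S (Pair s -` (?f -` H1 x \<inter> space (?M \<Otimes>\<^sub>M S))) \<partial>?M)"
      by (rule emeasure_pair_measure_alt[OF measurable_sets[OF f H1_sets[OF x]]])
    also have "\<dots> = (\<integral>\<^sup>+s. emeasure S (H (x \<otimes> c s)) \<partial>?M)"
    proof (intro nn_integral_cong arg_cong[where f = "emeasure S"])
      fix s
      show "Pair s -` (?f -` H1 x \<inter> space (?M \<Otimes>\<^sub>M S)) = H (x \<otimes> c s)"
        using step by (auto simp: space_pair_measure H_def[of "x \<otimes> c s"] cong: conj_cong)
    qed
    also have "\<dots> = avg (\<lambda>b. ennreal (pmf p b)) (\<lambda>y. emeasure S (H y)) x"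
      unfolding nn_integral_map_pmf by (simp add: avg_def nn_integral_measure_pmf c_def)
    finally show ?thesis .
  qed
  have "superharmonic (\<lambda>b. ennreal (pmf p b)) (\<lambda>y. emeasure S (H y))"
    unfolding superharmonic_def
  proof
    fix x assume x: "x \<in> carrier G"
    have "H1 x \<subseteq> H x" by (auto simp: H_def H1_def)
    then show "avg (\<lambda>b. ennreal (pmf p b)) (\<lambda>y. emeasure S (H y)) x \<le> emeasure S (H x)"
      unfolding first_step[OF x, symmetric] by (rule emeasure_mono[OF _ H_sets[OF x]])
  qed
  from harmonic_if_green_infinite[OF green this g]
  have "emeasure S (H1 g) = emeasure S (H g)"
    using emeasure_le_1[of "H g"] first_step[OF g] by (simp add: le_less_trans)
  also have "H g = space S"
    unfolding H_def by (auto simp: W_def intro!: exI[of _ 0])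
  finally have "emeasure S (H1 g) = 1" by (simp only: emeasure_space_1)
  then have "AE \<xi> in S. \<xi> \<in> H1 g"
    using H1_sets[OF g] by (simp add: AE_in_set_eq_1 emeasure_eq_measure)
  moreover have "AE \<xi> in S. \<forall>n. \<xi> n \<in> carrier G"
    unfolding AE_all_countable
    by (intro allI AE_component) (auto simp: AE_measure_pmf_iff)
  ultimately show "AE \<xi> in S. \<exists>n\<ge>1. walk G g \<xi> n = g"
    by eventually_elim (auto simp: H1_def W_def c_def)
qed

text \<open>
  A weight at the border between finite and infinite Green function need not have total mass 1; the
  multiplicative harmonic function turns it into a probability measure with the same support and the
  same Green function at the unit.
\<close>

lemma recurrent_group_if_critical:
  assumes count: "countable (carrier G)"
    and mono: "incseq w" and sup: "\<And>b. wlim b = (SUP j. w j b)"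
    and fin: "\<And>j. green (w j) \<one> < \<infinity>" and inf: "green wlim \<one> = \<infinity>"
    and gen: "semigroup_generate G (\<psi> ` {b. wlim b \<noteq> 0}) = carrier G"
  shows "recurrent_group G"
proof -
  obtain h where h1: "h \<one> = 1" and h_bounds: "\<And>x. x \<in> carrier G \<Longrightarrow> 0 < h x \<and> h x < \<infinity>"
    and h_mult: "\<And>x y. x \<in> carrier G \<Longrightarrow> y \<in> carrier G \<Longrightarrow> h (x \<otimes> y) = h x * h y"
    and h_avg: "avg wlim h \<one> = 1"
    using multiplicative_harmonic_function[OF mono sup fin inf gen] by blast
  define q where "q b = wlim b * h (\<psi> b)" for b
  have total: "(\<integral>\<^sup>+b. q b \<partial>count_space UNIV) = 1"
    using h_avg by (simp add: avg_def q_def)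
  have q_fin: "q b < \<infinity>" for b
    using nn_integral_ge_point[of b UNIV q] total by (simp add: le_less_trans)
  define p where "p = embed_pmf (\<lambda>b. enn2real (q b))"
  have p: "ennreal (pmf p b) = q b" for b
    unfolding p_def using q_fin total by (subst pmf_embed_pmf) auto
  have "(avg q ^^ n) (indicator {\<one>}) \<one> = (avg wlim ^^ n) (indicator {\<one>}) \<one>" for n
  proof -
    have "(\<lambda>y. h y * indicator {\<one>} y) = (indicator {\<one>} :: 'a \<Rightarrow> ennreal)"
      using h1 by (auto split: split_indicator)
    then show ?thesis
      using doob_transform_power[of h \<one> n wlim "indicator {\<one>}"] h_mult h1
      by (simp add: q_def[abs_def])
  qed
  then have "green (\<lambda>b. ennreal (pmf p b)) \<one> = \<infinity>"
    using inf by (simp add: green_def p)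
  then have "recurrent_walk G (map_pmf \<psi> p)"
    by (rule recurrent_walk_if_green_infinite[OF count])
  moreover have "set_pmf (map_pmf \<psi> p) = \<psi> ` {b. wlim b \<noteq> 0}"
  proof -
    have "pmf p b = 0 \<longleftrightarrow> wlim b = 0" for b
      using p[of b] h_bounds[of "\<psi> b"] by (auto simp: q_def ennreal_eq_0_iff[symmetric] pmf_nonneg)
    then have "set_pmf p = {b. wlim b \<noteq> 0}" by (simp add: set_pmf_eq)
    then show ?thesis by simp
  qed
  ultimately show ?thesis
    unfolding recurrent_group_def using gen by (intro exI[of _ "map_pmf \<psi> p"]) auto
qed

end

section \<open>Green functions as sums over words\<close>

lemma nn_integral_count_space_restrict:
  "(\<integral>\<^sup>+x. f x \<partial>count_space A) = (\<integral>\<^sup>+x. f x * indicator A x \<partial>count_space UNIV)"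
  by (rule nn_integral_count_space_indicator) simp

definition word_value :: "('g, 'b) monoid_scheme \<Rightarrow> ('i \<Rightarrow> 'g) \<Rightarrow> 'i list \<Rightarrow> 'g" where
  "word_value G \<theta> w = foldr (\<lambda>i g. \<theta> i \<otimes>\<^bsub>G\<^esub> g) w \<one>\<^bsub>G\<^esub>"

lemma word_value_simps [simp]:
  "word_value G \<theta> [] = \<one>\<^bsub>G\<^esub>"
  "word_value G \<theta> (i # w) = \<theta> i \<otimes>\<^bsub>G\<^esub> word_value G \<theta> w"
  by (simp_all add: word_value_def)

lemma (in monoid) word_value_closed [simp]:
  "(\<And>i. \<theta> i \<in> carrier G) \<Longrightarrow> word_value G \<theta> w \<in> carrier G"
  by (induction w) auto

lemma (in monoid) word_value_append:
  "(\<And>i. \<theta> i \<in> carrier G) \<Longrightarrow> word_value G \<theta> (u @ v) = word_value G \<theta> u \<otimes> word_value G \<theta> v"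
  by (induction u) (auto simp: m_assoc)

lemma (in monoid) word_value_concat:
  "(\<And>i. \<theta> i \<in> carrier G) \<Longrightarrow> word_value G \<theta> (concat bs) = word_value G (word_value G \<theta>) bs"
  by (induction bs) (auto simp: word_value_append)

lemma (in monoid) word_value_in_semigroup:
  assumes "\<And>i. i \<in> set w \<Longrightarrow> \<theta> i \<in> S" "w \<noteq> []" "S \<subseteq> carrier G"
  shows "word_value G \<theta> w \<in> semigroup_generate G S"
  using assms(1,2)
proof (induction w)
  case (Cons i w)
  then have i: "\<theta> i \<in> S" by simp
  show ?case
  proof (cases "w = []")
    case True
    then show ?thesis using i assms(3) by (auto simp: subset_iff intro: semigroup_generate.incl)
  next
    case False
    then show ?thesis using Cons i by (auto intro: semigroup_generate.intros)
  qed
qed simp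

context group_steps
begin

lemma avg_power_eq_words:
  assumes x: "x \<in> carrier G"
  shows "(avg w ^^ n) u x =
    (\<integral>\<^sup>+bs. (if length bs = n then prod_list (map w bs) * u (x \<otimes> word_value G \<psi> bs) else 0)
      \<partial>count_space UNIV)"
  using x
proof (induction n arbitrary: x)
  case 0
  have "(\<integral>\<^sup>+bs. (if length bs = 0 then prod_list (map w bs) * u (x \<otimes> word_value G \<psi> bs) else 0)
      \<partial>count_space UNIV) = (\<Sum>bs\<in>{[]}. (if length bs = 0 then prod_list (map w bs) * u (x \<otimes> word_value G \<psi> bs) else 0))"
    by (rule nn_integral_count_space') auto
  then show ?case using 0 by simp
next
  case (Suc n)
  let ?F = "\<lambda>n x bs. if length bs = n then prod_list (map w bs) * u (x \<otimes> word_value G \<psi> bs) else 0"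
  have "(avg w ^^ Suc n) u x = avg w (\<lambda>y. \<integral>\<^sup>+bs. ?F n y bs \<partial>count_space UNIV) x"
    using Suc.prems by (simp only: funpow.simps o_apply) (intro avg_cong Suc.IH)
  also have "\<dots> = (\<integral>\<^sup>+b. \<integral>\<^sup>+bs. w b * ?F n (x \<otimes> \<psi> b) bs \<partial>count_space UNIV \<partial>count_space UNIV)"
    unfolding avg_def by (simp only: nn_integral_cmult borel_measurable_count_space)
  also have "\<dots> = (\<integral>\<^sup>+b. \<integral>\<^sup>+bs. (\<lambda>(b, bs). ?F (Suc n) x (b # bs)) (b, bs)
      \<partial>count_space UNIV \<partial>count_space UNIV)"
    using Suc.prems by (intro nn_integral_cong) (simp add: m_assoc mult.assoc)
  also have "\<dots> = (\<integral>\<^sup>+p. (\<lambda>(b, bs). ?F (Suc n) x (b # bs)) p \<partial>count_space UNIV)"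
    by (rule nn_integral_fst_count_space[where f = "\<lambda>(b, bs). ?F (Suc n) x (b # bs)"])
  also have "\<dots> = (\<integral>\<^sup>+p. ?F (Suc n) x (case_prod (#) p) \<partial>count_space UNIV)"
    by (intro nn_integral_cong) (simp add: case_prod_unfold)
  also have "\<dots> = (\<integral>\<^sup>+bs. ?F (Suc n) x bs \<partial>count_space (- {[]}))"
  proof (rule nn_integral_bij_count_space[where f = "?F (Suc n) x"])
    show "bij_betw (case_prod (#)) UNIV (- {[]} :: 's list set)"
      by (rule bij_betw_byWitness[where f' = "\<lambda>bs. (hd bs, tl bs)"]) auto
  qed
  also have "\<dots> = (\<integral>\<^sup>+bs. ?F (Suc n) x bs \<partial>count_space UNIV)"
    unfolding nn_integral_count_space_restrict[where A = "- {[]}"]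
    by (intro nn_integral_cong) (auto split: split_indicator)
  finally show ?case .
qed

text \<open>
  Expanding the iterated kernel, the Green function at the unit is the weight of all words of steps
  whose product is trivial.
\<close>

lemma green_eq_words:
  "green w \<one> = (\<integral>\<^sup>+bs. prod_list (map w bs) * indicator {\<one>} (word_value G \<psi> bs) \<partial>count_space UNIV)"
proof -
  have "green w \<one> = (\<integral>\<^sup>+bs. (\<Sum>n. if length bs = n then prod_list (map w bs) * indicator {\<one>} (word_value G \<psi> bs) else 0)
      \<partial>count_space UNIV)"
    unfolding green_def by (subst nn_integral_suminf) (auto simp: avg_power_eq_words cong: if_cong)
  moreover have "(\<Sum>n. if length bs = n then c else 0) = c" for bs :: "'s list" and c :: ennreal
    by (subst suminf_finite[of "{length bs}"]) auto
  ultimately show ?thesis by simp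
qed

end

text \<open>
  A word \<open>w\<close> stands for the closed path \<open>w @ [a]\<close>. The empty word is included, so that loops form a
  monoid; it is free over the first return words.
\<close>

definition loop_words :: "'i set \<Rightarrow> ('i \<Rightarrow> 'i \<Rightarrow> bool) \<Rightarrow> 'i \<Rightarrow> 'i list set" where
  "loop_words I A a = {w. w = [] \<or> (hd w = a \<and> set w \<subseteq> I \<and> successively A (w @ [a]))}"

definition first_return_words :: "'i set \<Rightarrow> ('i \<Rightarrow> 'i \<Rightarrow> bool) \<Rightarrow> 'i \<Rightarrow> 'i list set" where
  "first_return_words I A a = {w \<in> loop_words I A a. w \<noteq> [] \<and> a \<notin> set (tl w)}"

lemma loop_words_append:
  "u \<in> loop_words I A a \<Longrightarrow> v \<in> loop_words I A a \<Longrightarrow> u @ v \<in> loop_words I A a"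
  by (cases "u = []"; cases "v = []") (auto simp: loop_words_def successively_append_iff)

lemma concat_first_returns_loop:
  "bs \<in> lists (first_return_words I A a) \<Longrightarrow> concat bs \<in> loop_words I A a"
proof (induction bs)
  case Nil
  then show ?case by (simp add: loop_words_def)
next
  case (Cons b bs)
  then show ?case by (auto simp: first_return_words_def intro: loop_words_append)
qed

text \<open>
  The first factor extends up to the next occurrence of \<open>a\<close>; the rest is a shorter loop.
\<close>

lemma loop_word_factorization:
  assumes "w \<in> loop_words I A a"
  shows "\<exists>bs\<in>lists (first_return_words I A a). concat bs = w"
  using assms
proof (induction "length w" arbitrary: w rule: less_induct)
  case less
  show ?case
  proof (cases "w = []")
    case True
    then show ?thesis by (intro bexI[of _ "[]"]) auto
  next
    case False
    with less.prems obtain t where w: "w = a # t" and I: "set w \<subseteq> I" and A: "successively A (w @ [a])"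
      by (cases w) (auto simp: loop_words_def)
    define b where "b = a # takeWhile (\<lambda>i. i \<noteq> a) t"
    define r where "r = dropWhile (\<lambda>i. i \<noteq> a) t"
    have split: "w = b @ r" by (simp add: w b_def r_def)
    have r: "r = [] \<or> hd r = a" unfolding r_def by (metis (mono_tags, lifting) hd_dropWhile)
    have sets: "set b \<subseteq> I" "set r \<subseteq> I" using I by (auto simp: split)
    have A': "successively A (b @ r @ [a])" using A by (simp add: split)
    then have "r \<in> loop_words I A a"
      using r sets by (auto simp: loop_words_def successively_append_iff)
    moreover have "length r < length w" by (simp add: split b_def)
    ultimately obtain bs where bs: "bs \<in> lists (first_return_words I A a)" "concat bs = r"
      using less.hyps by blast
    have "hd (r @ [a]) = a" using r by (cases r) auto
    then have "successively A (b @ [a])"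
      using A' by (auto simp: successively_append_iff)
    then have "b \<in> first_return_words I A a"
      using sets by (auto simp: first_return_words_def loop_words_def b_def dest: set_takeWhileD)
    with bs split show ?thesis by (intro bexI[of _ "b # bs"]) auto
  qed
qed

text \<open>
  The first factor can be read off from the concatenation, because the next factor, if any, starts
  with \<open>a\<close>. This makes the factorization unique.
\<close>

lemma first_return_word_recovered:
  assumes b: "b \<in> first_return_words I A a" and r: "r \<in> loop_words I A a"
  shows "b = a # takeWhile (\<lambda>i. i \<noteq> a) (tl (b @ r))"
proof -
  obtain v where v: "b = a # v" "a \<notin> set v"
    using b by (cases b) (auto simp: first_return_words_def loop_words_def)
  have "takeWhile (\<lambda>i. i \<noteq> a) r = []"
    using r by (cases r) (auto simp: loop_words_def)
  moreover have "takeWhile (\<lambda>i. i \<noteq> a) (v @ r) = v @ takeWhile (\<lambda>i. i \<noteq> a) r"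
    using v by (intro takeWhile_append2) auto
  ultimately show ?thesis using v by simp
qed

lemma concat_first_returns_bij:
  "bij_betw concat (lists (first_return_words I A a)) (loop_words I A a)"
proof (rule bij_betw_imageI)
  have "bs = cs" if "bs \<in> lists (first_return_words I A a)" "cs \<in> lists (first_return_words I A a)"
    "concat bs = concat cs" for bs cs
    using that
  proof (induction bs arbitrary: cs rule: list.induct)
    case Nil
    show ?case using Nil.prems(2,3) by (cases cs) (auto simp: first_return_words_def)
  next
    case (Cons b bs)
    have "b \<noteq> []" using Cons.prems(1) by (simp add: first_return_words_def)
    then obtain c cs' where cs: "cs = c # cs'"
      using Cons.prems(3) by (cases cs) auto
    have mem: "b \<in> first_return_words I A a" "c \<in> first_return_words I A a"
      "bs \<in> lists (first_return_words I A a)" "cs' \<in> lists (first_return_words I A a)"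
      using Cons.prems by (simp_all add: cs)
    have eq: "b @ concat bs = c @ concat cs'" using Cons.prems by (simp add: cs)
    have "b = a # takeWhile (\<lambda>i. i \<noteq> a) (tl (b @ concat bs))"
      by (rule first_return_word_recovered[OF mem(1) concat_first_returns_loop[OF mem(3)]])
    also have "\<dots> = c"
      unfolding eq
      by (rule first_return_word_recovered[OF mem(2) concat_first_returns_loop[OF mem(4)], symmetric])
    finally have "b = c" .
    moreover have "bs = cs'"
      by (rule Cons.IH[OF mem(3,4)]) (use eq \<open>b = c\<close> in simp)
    ultimately show ?case by (simp add: cs)
  qed
  then show "inj_on concat (lists (first_return_words I A a))" by (intro inj_onI)
  show "concat ` lists (first_return_words I A a) = loop_words I A a"
    by (intro subset_antisym image_subsetI subsetI) (metis concat_first_returns_loop loop_word_factorization image_eqI)+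
qed

definition first_return_weight :: "'i set \<Rightarrow> ('i \<Rightarrow> 'i \<Rightarrow> bool) \<Rightarrow> 'i \<Rightarrow> ('i \<Rightarrow> ennreal) \<Rightarrow> 'i list \<Rightarrow> ennreal" where
  "first_return_weight I A a r b =
     (if b \<in> first_return_words I A a then prod_list (map r b) else 0)"

definition trivial_loops ::
  "('g, 'b) monoid_scheme \<Rightarrow> ('i \<Rightarrow> 'g) \<Rightarrow> 'i set \<Rightarrow> ('i \<Rightarrow> 'i \<Rightarrow> bool) \<Rightarrow> 'i \<Rightarrow> nat \<Rightarrow> 'i list set" where
  "trivial_loops G \<theta> I A a n =
     {w \<in> loop_words I A a. length w = n \<and> word_value G \<theta> w = \<one>\<^bsub>G\<^esub>}"

lemma finite_trivial_loops: "finite I \<Longrightarrow> finite (trivial_loops G \<theta> I A a n)"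
  by (rule finite_subset[OF _ finite_lists_length_eq[of I n]])
     (auto simp: trivial_loops_def loop_words_def)

text \<open>
  Words of first return words are the same as loops, by unique factorization, so the convolution
  powers of the first return weight resum to all loops of trivial value, here grouped by their length
  in letters.
\<close>

lemma (in group) green_first_return_weight:
  assumes fin: "finite I" and \<theta>: "\<And>i. \<theta> i \<in> carrier G"
  shows "group_steps.green G (word_value G \<theta>) (first_return_weight I A a r) \<one> =
    (\<Sum>n. \<Sum>w\<in>trivial_loops G \<theta> I A a n. prod_list (map r w))"
proof -
  interpret group_steps G "word_value G \<theta>"
    by unfold_locales (use \<theta> in auto)
  let ?F = "first_return_words I A a" and ?L = "loop_words I A a"
  let ?f = "\<lambda>w. prod_list (map r w) * indicator {\<one>} (word_value G \<theta> w)"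
  have "green (first_return_weight I A a r) \<one> = (\<integral>\<^sup>+bs. ?f (concat bs) \<partial>count_space (lists ?F))"
  proof -
    have "prod_list (map (first_return_weight I A a r) bs) =
        prod_list (map r (concat bs)) * indicator (lists ?F) bs" for bs
      by (induction bs) (auto simp: first_return_weight_def split: split_indicator)
    then show ?thesis
      unfolding green_eq_words nn_integral_count_space_restrict[where A = "lists ?F"]
      by (intro nn_integral_cong) (simp add: word_value_concat \<theta> mult_ac)
  qed
  also have "\<dots> = (\<integral>\<^sup>+w. ?f w \<partial>count_space ?L)"
    by (rule nn_integral_bij_count_space[OF concat_first_returns_bij])
  also have "\<dots> = (\<integral>\<^sup>+w. (\<Sum>n. prod_list (map r w) * indicator (trivial_loops G \<theta> I A a n) w)
      \<partial>count_space UNIV)"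
    unfolding nn_integral_count_space_restrict[where A = ?L]
  proof (rule nn_integral_cong)
    fix w
    have "?f w * indicator ?L w = prod_list (map r w) * indicator (trivial_loops G \<theta> I A a (length w)) w"
      by (auto simp: trivial_loops_def indicator_def)
    also have "\<dots> = (\<Sum>n\<in>{length w}. prod_list (map r w) * indicator (trivial_loops G \<theta> I A a n) w)"
      by (simp only: sum.insert finite.emptyI empty_iff not_False_eq_True sum.empty add_0_right)
    also have "\<dots> = (\<Sum>n. prod_list (map r w) * indicator (trivial_loops G \<theta> I A a n) w)"
    proof (rule suminf_finite[symmetric])
      fix n assume "n \<notin> {length w}"
      then have "w \<notin> trivial_loops G \<theta> I A a n" by (simp add: trivial_loops_def)
      then show "prod_list (map r w) * indicator (trivial_loops G \<theta> I A a n) w = 0" by simp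
    qed simp
    finally show "?f w * indicator ?L w =
        (\<Sum>n. prod_list (map r w) * indicator (trivial_loops G \<theta> I A a n) w)" .
  qed
  also have "\<dots> = (\<Sum>n. \<integral>\<^sup>+w. prod_list (map r w) * indicator (trivial_loops G \<theta> I A a n) w
      \<partial>count_space UNIV)"
    by (rule nn_integral_suminf) simp
  also have "\<dots> = (\<Sum>n. \<Sum>w\<in>trivial_loops G \<theta> I A a n. prod_list (map r w))"
    unfolding nn_integral_count_space_restrict[symmetric]
    by (simp add: nn_integral_count_space_finite finite_trivial_loops fin)
  finally show ?thesis .
qed

section \<open>Periodic points of the group extension\<close>

lemma successively_iff_nth:
  "successively P xs \<longleftrightarrow> (\<forall>i. Suc i < length xs \<longrightarrow> P (xs ! i) (xs ! Suc i))"
proof (induction P xs rule: successively.induct)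
  case (3 P x y xs)
  have "(\<forall>i. Suc i < length (x # y # xs) \<longrightarrow> P ((x # y # xs) ! i) ((x # y # xs) ! Suc i)) \<longleftrightarrow>
      P x y \<and> (\<forall>i. Suc i < length (y # xs) \<longrightarrow> P ((y # xs) ! i) ((y # xs) ! Suc i))"
    (is "(\<forall>i. ?Q i) \<longleftrightarrow> _")
  proof -
    have "(\<forall>i. ?Q i) \<longleftrightarrow> ?Q 0 \<and> (\<forall>i. ?Q (Suc i))" by (metis not0_implies_Suc)
    then show ?thesis by simp
  qed
  with 3 show ?case by simp
qed auto

lemma left_shift_power: "(left_shift ^^ n) x = (\<lambda>k. x (k + n))"
  by (induction n) (auto simp: left_shift_def)

lemma periodic_mod:
  fixes x :: "nat \<Rightarrow> 'c"
  assumes "\<And>k. x (k + n) = x k"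
  shows "x k = x (k mod n)"
proof -
  have "x (j + m * n) = x j" for j m
    by (induction m) (auto simp: assms add.assoc[symmetric] add.commute[of n])
  from this[of "k mod n" "k div n"] show ?thesis by simp
qed

text \<open>
  The group coordinate of a point of the extension is determined by its start and by the letters, and
  it is periodic exactly when the period word has trivial value. So a periodic point through \<open>(a, g)\<close>
  is the same as a loop at \<open>a\<close> of trivial value, whatever \<open>g\<close> is.
\<close>

lemma (in group) periodic_points_bij_trivial_loops:
  fixes \<Psi> :: "'i list \<Rightarrow> 'a"
  assumes \<theta>: "\<And>i. \<theta> i \<in> carrier G" "\<And>i. i \<in> I \<Longrightarrow> \<theta> i = \<Psi> [i]"
    and g: "g \<in> carrier G" and n: "0 < n"
  shows "bij_betw (\<lambda>x. map (\<lambda>k. fst (x k)) [0..<n])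
    {x \<in> markov_shift (I \<times> carrier G) (extension_matrix A G \<Psi>). x 0 = (a, g) \<and> (left_shift ^^ n) x = x}
    (trivial_loops G \<theta> I A a n)"
proof (rule bij_betw_byWitness[where
    f' = "\<lambda>w k. (w ! (k mod n), g \<otimes> word_value G \<theta> (take (k mod n) w))"])
  let ?S = "{x \<in> markov_shift (I \<times> carrier G) (extension_matrix A G \<Psi>). x 0 = (a, g) \<and> (left_shift ^^ n) x = x}"
  let ?f = "\<lambda>x. map (\<lambda>k. fst (x k)) [0..<n]"
  let ?f' = "\<lambda>w k. (w ! (k mod n), g \<otimes> word_value G \<theta> (take (k mod n) w))"
  have S: "proj_base x \<in> markov_shift I A \<and> (\<forall>n. snd (x n) \<in> carrier G) \<and>
      (\<forall>n. snd (x n) \<otimes> \<Psi> [fst (x n)] = snd (x (Suc n))) \<and> x 0 = (a, g) \<and> (left_shift ^^ n) x = x"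
    if "x \<in> ?S" for x
    using that by (simp add: markov_shift_extension)
  have fst_in: "fst (x k) \<in> I" and adj: "A (fst (x k)) (fst (x (Suc k)))"
    and step: "snd (x (Suc k)) = snd (x k) \<otimes> \<theta> (fst (x k))"
    and start: "x 0 = (a, g)" and per: "x (k + n) = x k" if "x \<in> ?S" for x k
    using S[OF that] \<theta>(2) by (auto simp: proj_base_def markov_shift_def left_shift_power fun_eq_iff)
  have position: "snd (x k) = g \<otimes> word_value G \<theta> (map (\<lambda>k. fst (x k)) [0..<k])" if "x \<in> ?S" for x k
  proof (induction k)
    case 0
    then show ?case using start[OF that] g by simp
  next
    case (Suc k)
    then show ?case using g by (simp add: step[OF that] word_value_append \<theta>(1) m_assoc)
  qed
  show "\<forall>x\<in>?S. ?f' (?f x) = x"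
  proof
    fix x assume x: "x \<in> ?S"
    have "?f' (?f x) k = x k" for k
    proof -
      have "k mod n < n" using n by simp
      then have "?f' (?f x) k = (fst (x (k mod n)), snd (x (k mod n)))"
        by (simp add: position[OF x, of "k mod n"] take_map)
      also have "\<dots> = x k" using periodic_mod[of x n k] per[OF x] by simp
      finally show ?thesis .
    qed
    then show "?f' (?f x) = x" by blast
  qed
  show "\<forall>w\<in>trivial_loops G \<theta> I A a n. ?f (?f' w) = w"
    by (auto simp: trivial_loops_def intro!: nth_equalityI)
  show "?f ` ?S \<subseteq> trivial_loops G \<theta> I A a n"
  proof (rule image_subsetI)
    fix x assume x: "x \<in> ?S"
    have xn: "x n = (a, g)" using per[OF x, of 0] start[OF x] by simp
    have "?f x @ [a] = map (\<lambda>k. fst (x k)) [0..<Suc n]" using xn by simp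
    then have "successively A (?f x @ [a])"
      using adj[OF x] by (simp add: successively_iff_nth del: upt_Suc)
    moreover have "hd (?f x) = a" using n start[OF x] by (simp add: hd_map)
    moreover have "word_value G \<theta> (?f x) = \<one>"
      using position[OF x, of n] xn g by (simp add: \<theta>(1) l_cancel_one')
    ultimately show "?f x \<in> trivial_loops G \<theta> I A a n"
      using fst_in[OF x] by (auto simp: trivial_loops_def loop_words_def)
  qed
  show "?f' ` trivial_loops G \<theta> I A a n \<subseteq> ?S"
  proof (rule image_subsetI)
    fix w assume "w \<in> trivial_loops G \<theta> I A a n"
    then have len: "length w = n" and I: "set w \<subseteq> I" and hd: "w ! 0 = a"
      and A: "successively A (w @ [a])" and w1: "word_value G \<theta> w = \<one>"
      using n by (auto simp: trivial_loops_def loop_words_def hd_conv_nth)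
    have lt: "k mod n < n" for k using n by simp
    have in_I: "w ! (k mod n) \<in> I" for k using I lt[of k] len by (meson nth_mem subsetD)
    have trans: "extension_matrix A G \<Psi> (?f' w k) (?f' w (Suc k))" for k
    proof -
      define j where "j = k mod n"
      have j: "j < n" using lt by (simp add: j_def)
      have A_j: "A (w ! j) ((w @ [a]) ! Suc j)"
        using A j len by (auto simp: successively_iff_nth nth_append dest!: spec[of _ j])
      have val_j: "word_value G \<theta> (take j w) \<otimes> \<Psi> [w ! j] = word_value G \<theta> (take (Suc j) w)"
        using j len \<theta>(2)[OF in_I[of k], symmetric]
        by (simp add: take_Suc_conv_app_nth word_value_append \<theta>(1) j_def)
      have \<Psi>_j: "\<Psi> [w ! j] \<in> carrier G" using \<theta>(1)[of "w ! j"] \<theta>(2)[of "w ! j"] in_I[of k] by (simp add: j_def)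
      have eq: "g \<otimes> word_value G \<theta> (take j w) \<otimes> \<Psi> [w ! j] = g \<otimes> word_value G \<theta> (take (Suc j) w)"
        using g \<Psi>_j by (simp add: m_assoc \<theta>(1) val_j)
      show ?thesis
      proof (cases "Suc j = n")
        case True
        then have "Suc k mod n = 0" by (simp add: mod_Suc j_def)
        then show ?thesis
          using A_j eq True len hd w1 by (simp add: extension_matrix_def j_def[symmetric] nth_append)
      next
        case False
        then have "Suc k mod n = Suc j" "Suc j < n" using j by (simp_all add: mod_Suc j_def)
        then show ?thesis
          using A_j eq len by (simp add: extension_matrix_def j_def[symmetric] nth_append)
      qed
    qed
    have "?f' w \<in> markov_shift (I \<times> carrier G) (extension_matrix A G \<Psi>)"
      unfolding markov_shift_def using trans in_I g by (auto simp: \<theta>(1))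
    moreover have "?f' w 0 = (a, g)" using hd g by simp
    ultimately show "?f' w \<in> ?S" by (simp add: left_shift_power)
  qed
qed

lemma birkhoff_sum_first_coordinate:
  fixes G :: "('g, 'b) monoid_scheme"
  assumes "depends_on_first_coordinate (markov_shift I A) \<phi>"
  obtains f where "\<And>\<Psi> n x. x \<in> markov_shift (I \<times> carrier G) (extension_matrix A G \<Psi>) \<Longrightarrow>
    birkhoff_sum n (\<phi> \<circ> proj_base) x = sum_list (map f (map (\<lambda>k. fst (x k)) [0..<n]))"
proof
  define f where "f i = \<phi> (SOME \<omega>. \<omega> \<in> markov_shift I A \<and> \<omega> 0 = i)" for i
  fix \<Psi> n x
  assume x: "x \<in> markov_shift (I \<times> carrier G) (extension_matrix A G \<Psi>)"
  have "\<phi> (proj_base ((left_shift ^^ k) x)) = f (fst (x k))" for k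
  proof -
    let ?y = "proj_base ((left_shift ^^ k) x)"
    have y: "?y \<in> markov_shift I A \<and> ?y 0 = fst (x k)"
      using x by (simp add: markov_shift_extension) (simp add: left_shift_power proj_base_def markov_shift_def)
    define \<omega> where "\<omega> = (SOME \<omega>. \<omega> \<in> markov_shift I A \<and> \<omega> 0 = fst (x k))"
    have \<omega>: "\<omega> \<in> markov_shift I A \<and> \<omega> 0 = fst (x k)"
      unfolding \<omega>_def by (rule someI[of _ ?y]) (rule y)
    have "\<phi> ?y = \<phi> \<omega>"
      using assms[unfolded depends_on_first_coordinate_def, rule_format, of ?y \<omega>] y \<omega> by argo
    then show ?thesis by (simp only: f_def \<omega>_def)
  qed
  then show "birkhoff_sum n (\<phi> \<circ> proj_base) x = sum_list (map f (map (\<lambda>k. fst (x k)) [0..<n]))"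
    by (simp add: birkhoff_sum_def interv_sum_list_conv_sum_set_nat o_def atLeast0LessThan)
qed

lemma prod_list_scale:
  fixes c :: "'c :: comm_monoid_mult"
  shows "prod_list (map (\<lambda>i. c * r i) w) = c ^ length w * prod_list (map r w)"
  by (induction w) (auto simp: mult_ac)

lemma prod_list_exp:
  "prod_list (map (\<lambda>i. ennreal (exp (f i))) w) = ennreal (exp (sum_list (map f w)))"
  by (induction w) (auto simp: exp_add ennreal_mult)

text \<open>
  The root test: \<open>P\<close> is the exponential growth rate of \<open>Z\<close>, so damping by \<open>s < 1\<close> makes the series
  finite. The slack \<open>e\<close> is half of \<open>- ln s\<close>, which leaves the geometric ratio \<open>exp (- e)\<close>.
\<close>

lemma finite_below_growth_rate:
  assumes lim: "limsup (\<lambda>n. extended_ln (Z n) / ereal (real n)) = ereal P"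
    and fin: "\<And>n. 0 < n \<Longrightarrow> Z n < \<infinity>" and s: "0 < s" "s < 1"
  shows "(\<Sum>n. ennreal (s ^ Suc n * exp (- real (Suc n) * P)) * Z (Suc n)) < \<infinity>"
proof -
  define e where "e = - ln s / 2"
  have e: "e > 0" using s by (simp add: e_def)
  define t where "t n = s ^ Suc n * exp (- real (Suc n) * P) * enn2real (Z (Suc n))" for n
  have "\<forall>\<^sub>F n in sequentially. extended_ln (Z n) / ereal (real n) < ereal (P + e)"
    using lim e by (intro Limsup_lessD) simp
  then have "\<forall>\<^sub>F n in sequentially. extended_ln (Z (Suc n)) / ereal (real (Suc n)) < ereal (P + e)"
    by (subst eventually_sequentially_Suc)
  then have "\<forall>\<^sub>F n in sequentially. norm (t n) \<le> exp (- e) ^ Suc n"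
  proof eventually_elim
    case (elim n)
    let ?N = "real (Suc n)"
    have Z: "enn2real (Z (Suc n)) \<le> exp (?N * (P + e))"
    proof (cases "Z (Suc n) = 0")
      case False
      define z where "z = enn2real (Z (Suc n))"
      have z: "z > 0" using False fin[of "Suc n"] by (simp add: z_def enn2real_positive_iff zero_less_iff_neq_zero)
      have "extended_ln (Z (Suc n)) = ereal (ln z)"
        using False fin[of "Suc n"] by (simp add: extended_ln_def z_def)
      with elim have "ln z / ?N < P + e" by simp
      then have "ln z < ?N * (P + e)" by (simp add: pos_divide_less_eq mult.commute)
      then have "z \<le> exp (?N * (P + e))" using z by (metis exp_le_cancel_iff exp_ln less_imp_le)
      then show ?thesis by (simp add: z_def)
    qed simp
    have "norm (t n) \<le> s ^ Suc n * exp (- ?N * P) * exp (?N * (P + e))"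
      unfolding t_def using s Z by (auto simp: abs_mult intro!: mult_left_mono)
    also have "s ^ Suc n = exp (?N * ln s)" using s by (simp only: exp_of_nat_mult exp_ln)
    also have "exp (?N * ln s) * exp (- ?N * P) * exp (?N * (P + e)) = exp (?N * (- e))"
      unfolding exp_add[symmetric] e_def by (simp add: field_simps)
    also have "\<dots> = exp (- e) ^ Suc n" by (rule exp_of_nat_mult)
    finally show ?case .
  qed
  moreover have "summable (\<lambda>n. exp (- e) ^ Suc n)"
    using e by (subst summable_Suc_iff) (simp add: summable_geometric)
  ultimately have "summable t" by (rule summable_comparison_test_ev)
  moreover have "0 \<le> t n" for n using s by (simp add: t_def)
  ultimately have "(\<Sum>n. ennreal (t n)) \<noteq> \<infinity>" by (simp add: ennreal_suminf_neq_top)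
  moreover have "ennreal (t n) = ennreal (s ^ Suc n * exp (- real (Suc n) * P)) * Z (Suc n)" for n
    using s fin[of "Suc n"] unfolding t_def by (subst ennreal_mult) auto
  ultimately show ?thesis by (simp add: top.not_eq_extremum)
qed

lemma partition_function_extension:
  assumes "finite I" "group G" "\<And>i. \<theta> i \<in> carrier G" "\<And>i. i \<in> I \<Longrightarrow> \<theta> i = \<Psi> [i]"
    "g \<in> carrier G" "0 < n"
    and f: "\<And>x. x \<in> markov_shift (I \<times> carrier G) (extension_matrix A G \<Psi>) \<Longrightarrow>
      birkhoff_sum n F x = sum_list (map f (map (\<lambda>k. fst (x k)) [0..<n]))"
  shows "partition_function (I \<times> carrier G) (extension_matrix A G \<Psi>) F (a, g) n =
    (\<Sum>w\<in>trivial_loops G \<theta> I A a n. ennreal (exp (sum_list (map f w))))"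
proof -
  let ?S = "{x \<in> markov_shift (I \<times> carrier G) (extension_matrix A G \<Psi>). x 0 = (a, g) \<and> (left_shift ^^ n) x = x}"
  let ?f = "\<lambda>x. map (\<lambda>k. fst (x k)) [0..<n]"
  have bij: "bij_betw ?f ?S (trivial_loops G \<theta> I A a n)"
    by (rule group.periodic_points_bij_trivial_loops) (use assms in auto)
  then have "finite ?S" using finite_trivial_loops[OF assms(1)] bij_betw_finite by blast
  then have "partition_function (I \<times> carrier G) (extension_matrix A G \<Psi>) F (a, g) n =
      (\<Sum>x\<in>?S. ennreal (exp (birkhoff_sum n F x)))"
    unfolding partition_function_def by (rule infsum_finite)
  also have "\<dots> = (\<Sum>x\<in>?S. ennreal (exp (sum_list (map f (?f x)))))"
    by (intro sum.cong refl) (simp only: mem_Collect_eq f)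
  also have "\<dots> = (\<Sum>w\<in>trivial_loops G \<theta> I A a n. ennreal (exp (sum_list (map f w))))"
    by (rule sum.reindex_bij_betw[OF bij])
  finally show ?thesis .
qed

lemma (in group) extension_path_value:
  assumes "successively (extension_matrix A G \<Psi>) (p @ [(j, h)])" "p \<noteq> []" "hd p = (i, g)"
    "set p \<subseteq> I \<times> carrier G"
    and \<theta>: "\<And>i. \<theta> i \<in> carrier G" "\<And>i. i \<in> I \<Longrightarrow> \<theta> i = \<Psi> [i]"
  shows "h = g \<otimes> word_value G \<theta> (map fst p) \<and> successively A (map fst p @ [j])"
  using assms(1-4)
proof (induction p arbitrary: i g)
  case (Cons q p)
  show ?case
  proof (cases p)
    case Nil
    then show ?thesis using Cons.prems by (auto simp: extension_matrix_def \<theta>(1) \<theta>(2)[symmetric])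
  next
    case (Cons q' p')
    obtain i' g' where q': "q' = (i', g')" by (cases q')
    have "h = g' \<otimes> word_value G \<theta> (map fst p) \<and> successively A (map fst p @ [j])"
      using Cons.IH[of i' g'] Cons.prems Cons q' by simp
    moreover have "A i i'" "g \<otimes> \<Psi> [i] = g'"
      using Cons.prems Cons q' by (auto simp: extension_matrix_def)
    ultimately show ?thesis
      using Cons.prems Cons q' by (auto simp: m_assoc \<theta>(1) \<theta>(2)[symmetric])
  qed
qed simp

text \<open>
  An admissible path of the extension from \<open>(a, \<one>)\<close> to \<open>(a, g)\<close> projects to a nonempty loop at \<open>a\<close> of
  value \<open>g\<close>; its factorization writes \<open>g\<close> as a nonempty product of values of first return words.
\<close>

lemma (in group) first_return_values_generate:
  assumes irr: "irreducible_shift (I \<times> carrier G) (extension_matrix A G \<Psi>)"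
    and \<theta>: "\<And>i. \<theta> i \<in> carrier G" "\<And>i. i \<in> I \<Longrightarrow> \<theta> i = \<Psi> [i]" and a: "a \<in> I"
  shows "semigroup_generate G (word_value G \<theta> ` first_return_words I A a) = carrier G"
proof
  let ?S = "word_value G \<theta> ` first_return_words I A a"
  have S: "?S \<subseteq> carrier G" using \<theta>(1) by auto
  show "semigroup_generate G ?S \<subseteq> carrier G"
  proof
    fix g assume "g \<in> semigroup_generate G ?S"
    then show "g \<in> carrier G" by induction (use S in auto)
  qed
  show "carrier G \<subseteq> semigroup_generate G ?S"
  proof
    fix g assume g: "g \<in> carrier G"
    obtain v where v: "[(a, \<one>)] @ v @ [(a, g)] \<in> admissible_words (I \<times> carrier G) (extension_matrix A G \<Psi>)"
      using irr[unfolded irreducible_shift_def, rule_format, of "(a, \<one>)" "(a, g)"] a g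
      by (fastforce simp only: mem_Sigma_iff one_closed)
    define p where "p = (a, \<one>) # v"
    have p: "successively (extension_matrix A G \<Psi>) (p @ [(a, g)])" "set p \<subseteq> I \<times> carrier G"
      using v by (auto simp: admissible_words_def p_def)
    have val: "g = \<one> \<otimes> word_value G \<theta> (map fst p) \<and> successively A (map fst p @ [a])"
      by (rule extension_path_value[OF p(1) _ _ p(2)]) (use \<theta> in \<open>auto simp: p_def\<close>)
    have "map fst p \<in> loop_words I A a"
    proof -
      have "set (map fst p) \<subseteq> I" using p(2) by auto
      then show ?thesis using val by (simp add: loop_words_def) (simp add: p_def)
    qed
    then obtain bs where bs: "bs \<in> lists (first_return_words I A a)" "concat bs = map fst p"
      by (rule bexE[OF loop_word_factorization])
    have "word_value G (word_value G \<theta>) bs \<in> semigroup_generate G ?S"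
    proof (rule word_value_in_semigroup[OF _ _ S])
      show "word_value G \<theta> b \<in> ?S" if "b \<in> set bs" for b
        using that bs(1) by (intro imageI) (simp add: in_lists_conv_set)
      show "bs \<noteq> []" using bs(2) by (intro notI) (simp add: p_def)
    qed
    moreover have "g = word_value G (word_value G \<theta>) bs"
    proof -
      have "word_value G (word_value G \<theta>) bs = word_value G \<theta> (map fst p)"
        using word_value_concat[where \<theta> = \<theta> and bs = bs] \<theta>(1) bs(2) by simp
      then show ?thesis using val l_one word_value_closed[where \<theta> = \<theta>] \<theta>(1) by metis
    qed
    ultimately show "g \<in> semigroup_generate G ?S" by simp
  qed
qed

theorem proposition1p9:
  fixes I :: "'i set" and A :: "'i \<Rightarrow> 'i \<Rightarrow> bool"
    and G :: "('g, 'b) monoid_scheme" and \<Psi> :: "'i list \<Rightarrow> 'g"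
    and \<phi> :: "(nat \<Rightarrow> 'i) \<Rightarrow> real"
  assumes "finite I"
    and "group G" and "countable (carrier G)"
    and "\<Psi> \<in> hom (free_semigroup I) G"
    and "irreducible_shift (I \<times> carrier G) (extension_matrix A G \<Psi>)"
    and "depends_on_first_coordinate (markov_shift I A) \<phi>"
    and "recurrent_potential (I \<times> carrier G) (extension_matrix A G \<Psi>) (\<phi> \<circ> proj_base)"
  shows "recurrent_group G"
proof -
  interpret group G by fact
  \<comment> \<open>The default value outside the alphabet makes \<open>\<theta>\<close> total with values in the carrier.\<close>
  define \<theta> where "\<theta> i = (if i \<in> I then \<Psi> [i] else \<one>\<^bsub>G\<^esub>)" for i
  have \<theta>_closed: "\<theta> i \<in> carrier G" for i
    using assms(4) by (auto simp: \<theta>_def hom_def free_semigroup_def)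
  have \<theta>_\<Psi>: "\<theta> i = \<Psi> [i]" if "i \<in> I" for i using that by (simp add: \<theta>_def)
  obtain f where f: "\<And>n x. x \<in> markov_shift (I \<times> carrier G) (extension_matrix A G \<Psi>) \<Longrightarrow>
      birkhoff_sum n (\<phi> \<circ> proj_base) x = sum_list (map f (map (\<lambda>k. fst (x k)) [0..<n]))"
    using birkhoff_sum_first_coordinate[OF assms(6)] by metis
  obtain a g P where a: "a \<in> I" and g: "g \<in> carrier G"
    and P: "gurevich_pressure (I \<times> carrier G) (extension_matrix A G \<Psi>) (\<phi> \<circ> proj_base) (a, g) = ereal P"
    and div: "(\<Sum>n. ennreal (exp (- real (Suc n) * P)) *
      partition_function (I \<times> carrier G) (extension_matrix A G \<Psi>) (\<phi> \<circ> proj_base) (a, g) (Suc n)) = \<infinity>"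
    using assms(7) unfolding recurrent_potential_def by auto
  define Z where "Z = partition_function (I \<times> carrier G) (extension_matrix A G \<Psi>) (\<phi> \<circ> proj_base) (a, g)"
  have Z: "Z n = (\<Sum>w\<in>trivial_loops G \<theta> I A a n. ennreal (exp (sum_list (map f w))))" if "0 < n" for n
    unfolding Z_def
    by (rule partition_function_extension[where f = f and \<theta> = \<theta>])
       (use assms(1,2) \<theta>_closed \<theta>_\<Psi> g that f in auto)
  \<comment> \<open>The factor \<open>s\<close> is put on every letter, so that it counts the period and not the number of returns.\<close>
  define r where "r s i = ennreal s * ennreal (exp (f i - P))" for s i
  have r_loops: "(\<Sum>w\<in>trivial_loops G \<theta> I A a n. prod_list (map (r s) w)) =
      ennreal (s ^ n * exp (- real n * P)) * Z n" if "0 < n" "0 \<le> s" for s n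
  proof -
    have "prod_list (map (r s) w) = ennreal (s ^ n * exp (- real n * P)) * ennreal (exp (sum_list (map f w)))"
      if w: "w \<in> trivial_loops G \<theta> I A a n" for w
    proof -
      have "r s = (\<lambda>i. ennreal (s * exp (- P)) * ennreal (exp (f i)))"
        using \<open>0 \<le> s\<close> by (auto simp: r_def fun_eq_iff ennreal_mult[symmetric] exp_diff exp_minus field_simps)
      then have "prod_list (map (r s) w) = ennreal (s * exp (- P)) ^ n * ennreal (exp (sum_list (map f w)))"
        using w by (simp add: prod_list_scale prod_list_exp trivial_loops_def)
      also have "ennreal (s * exp (- P)) ^ n = ennreal (s ^ n * exp (- real n * P))"
        using \<open>0 \<le> s\<close> by (simp add: ennreal_power power_mult_distrib exp_of_nat_mult[symmetric])
      finally show ?thesis .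
    qed
    then show ?thesis using \<open>0 < n\<close> by (simp add: Z sum_distrib_left del: sum_ennreal)
  qed
  interpret group_steps G "word_value G \<theta>"
    by unfold_locales (simp add: \<theta>_closed)
  have green: "green (first_return_weight I A a (r s)) \<one>\<^bsub>G\<^esub> =
      (\<Sum>n. ennreal (s ^ Suc n * exp (- real (Suc n) * P)) * Z (Suc n)) +
      (\<Sum>w\<in>trivial_loops G \<theta> I A a 0. prod_list (map (r s) w))" if "0 \<le> s" for s
    using that unfolding green_first_return_weight[OF assms(1) \<theta>_closed]
    by (subst suminf_offset[of _ 1]) (simp_all add: r_loops del: power_Suc)
  \<comment> \<open>Any sequence in \<open>(0, 1)\<close> increasing to 1 would do.\<close>
  define s where "s j = real (Suc j) / real (Suc (Suc j))" for j
  have s: "0 < s j" "s j < 1" "s j \<le> s (Suc j)" for j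
    by (auto simp: s_def field_simps)
  have s_lim: "s \<longlonglongrightarrow> 1"
    unfolding s_def by (rule LIMSEQ_Suc[OF LIMSEQ_n_over_Suc_n])
  have weight: "first_return_weight I A a (r t) b =
      ennreal t ^ length b * first_return_weight I A a (r 1) b" if "0 \<le> t" for t b
    by (simp add: first_return_weight_def r_def[abs_def] prod_list_scale)
  let ?w = "\<lambda>j. first_return_weight I A a (r (s j))" and ?wlim = "first_return_weight I A a (r 1)"
  show ?thesis
  proof (rule recurrent_group_if_critical[OF assms(3), where w = ?w and wlim = ?wlim])
    have mono_pow: "incseq (\<lambda>j. ennreal (s j) ^ m)" for m
      using s by (intro incseq_SucI power_mono ennreal_leI) auto
    show "incseq ?w"
      using mono_pow s(1)
      by (auto simp: incseq_def le_fun_def weight[OF less_imp_le[OF s(1)]] intro!: mult_right_mono)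
    show "?wlim b = (SUP j. ?w j b)" for b
    proof -
      have "(\<lambda>j. ennreal (s j ^ length b)) \<longlonglongrightarrow> ennreal (1 ^ length b)"
        by (intro tendsto_ennrealI tendsto_power s_lim)
      then have "(SUP j. ennreal (s j) ^ length b) = 1"
        using LIMSEQ_unique[OF LIMSEQ_SUP[OF mono_pow]] s(1) by (simp add: ennreal_power less_imp_le)
      then show ?thesis
        unfolding weight[OF less_imp_le[OF s(1)]] SUP_mult_right_ennreal[symmetric] by simp
    qed
    have Z_fin: "Z n < \<infinity>" if "0 < n" for n
      using that by (simp add: Z finite_trivial_loops[OF assms(1)] ennreal_less_top)
    show "green (?w j) \<one>\<^bsub>G\<^esub> < \<infinity>" for j
    proof -
      have "(\<Sum>n. ennreal (s j ^ Suc n * exp (- real (Suc n) * P)) * Z (Suc n)) < \<infinity>"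
        using P Z_fin s(1,2) unfolding gurevich_pressure_def Z_def[symmetric]
        by (rule finite_below_growth_rate)
      moreover have "(\<Sum>w\<in>trivial_loops G \<theta> I A a 0. prod_list (map (r (s j)) w)) < \<infinity>"
      proof -
        have "trivial_loops G \<theta> I A a 0 = {[]}"
          by (auto simp: trivial_loops_def loop_words_def)
        then show ?thesis by simp
      qed
      ultimately show ?thesis using s(1)[of j] by (simp add: green less_imp_le del: power_Suc)
    qed
    show "green ?wlim \<one>\<^bsub>G\<^esub> = \<infinity>"
      using div by (simp add: green Z_def)
    have "{b. ?wlim b \<noteq> 0} = first_return_words I A a"
      by (auto simp: first_return_weight_def r_def prod_list_zero_iff)
    then show "semigroup_generate G (word_value G \<theta> ` {b. ?wlim b \<noteq> 0}) = carrier G"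
      using first_return_values_generate[OF assms(5) \<theta>_closed \<theta>_\<Psi> a] by simp
  qed
qed

end
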